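(* Let $\Gamma=(V,E,w)$ be a finite, simple, connected, undirected weighted graph with $V=V_0\sqcup V_b$ and $V_b\ne\emptyset$, let $D=\max_{x\in V}|I(x)|$, let $\lambda>0$, let $h:\mathbb{R}^2\to\mathbb{R}$ and the continuous function $m:\mathbb{R}\to\mathbb{R}$ be as in the context, and let $\bar\rho:V\to\mathbb{R}$. Assume that $\lambda D\|m\|_{L^\infty(0,1)}<1$ and $0\le\bar\rho(x)<1$ for all $x\in V$. Then the discrete Hughes' system $$\left\{\begin{array}{ll}\rho^{n+1}(x)=\rho^n(x)-\sum\limits_{y\sim x}\lambda\,h^n_{yx}\,\mathrm{sgn}(u^n(y)-u^n(x)), & x\in V,\\[4pt] \max\limits_{y\sim x}\left\{-\dfrac{u^n(y)-u^n(x)}{w_{yx}}-\dfrac{1}{1-\rho^n(y)}\right\}=0, & x\in V_0,\\[4pt] \rho^0(x)=\bar\rho(x), & x\in V,\\ u^n(x)=0, & x\in V_b,\end{array}\right.$$ is well defined for all $n\in\mathbb{N}$; that is, there is a unique pair of sequences of functions $\rho^n:V\to\mathbb{R}$, $u^n:V\to\mathbb{R}$ ($n\in\mathbb{N}$, $n\geq 0$) such that, for all $n$, $\rho^n(x)<1$ for every $x\in V$ (so that the cost $1/(1-\rho^n)$ is finite) and the system holds.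
   Context: The graph $\Gamma=(V,E,w)$ has vertex set $V$, edge set $E\subset V\times V$ and weights $w_{xy}$ with $w_{xy}>0$ if $(x,y)\in E$, $w_{xy}=0$ otherwise, $w_{xy}=w_{yx}$. One writes $y\sim x$ if $(x,y)\in E$, and $I(x)=\{y\in V:y\sim x\}$. $V_b\subset V$ is a designated set of boundary vertices and $V_0=V\setminus V_b$. The function $h=h(v,u)$ has partial derivatives $h_v$ (in the first argument) and $h_u$ (in the second argument) and satisfies $h(0,0)=h(1,1)=0$ and, for all $v,u$, $$m_-(v)\le h_v(v,u)\le 0\le h_u(v,u)\le m_+(u),$$ where $m:\mathbb{R}\to\mathbb{R}$ is continuous, $a_-=\min(a,0)$, $a_+=\max(a,0)$, and $m_\pm(v)=(m(v))_\pm$. With $\delta^n_{yx}=\mathrm{sgn}(u^n(y)-u^n(x))$ (and $\mathrm{sgn}(0)=0$), the flux is $h^n_{yx}=h(\rho^n(y),\rho^n(x))$ if $\delta^n_{yx}=1$ and $h^n_{yx}=h(\rho^n(x),\rho^n(y))$ if $\delta^n_{yx}=-1$; when $\delta^n_{yx}=0$ the product $h^n_{yx}\delta^n_{yx}$ is $0$. *)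

theory Defs
  imports
    "HOL-Probability.Essential_Supremum"
    "Graph_Theory.Graph_Theory"
begin

definition nbrs :: "'a pair_pre_digraph \<Rightarrow> 'a \<Rightarrow> 'a set" where
  "nbrs G x = {y \<in> pverts G. (x, y) \<in> parcs G}"

definition max_degree :: "'a pair_pre_digraph \<Rightarrow> nat" where
  "max_degree G = Max ((\<lambda>x. card (nbrs G x)) ` pverts G)"

definition graph_weight :: "'a pair_pre_digraph \<Rightarrow> ('a \<Rightarrow> 'a \<Rightarrow> real) \<Rightarrow> bool" where
  "graph_weight G w \<longleftrightarrow>
     (\<forall>x\<in>pverts G. \<forall>y\<in>pverts G.
        ((x, y) \<in> parcs G \<longrightarrow> w x y > 0) \<and>
        ((x, y) \<notin> parcs G \<longrightarrow> w x y = 0) \<and>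
        w x y = w y x)"

definition Linfty_norm :: "real set \<Rightarrow> (real \<Rightarrow> real) \<Rightarrow> ereal" where
  "Linfty_norm S f = esssup (lebesgue_on S) (\<lambda>x. ereal \<bar>f x\<bar>)"

definition admissible_flux :: "(real \<Rightarrow> real \<Rightarrow> real) \<Rightarrow> (real \<Rightarrow> real) \<Rightarrow> bool" where
  "admissible_flux h m \<longleftrightarrow>
     h 0 0 = 0 \<and> h 1 1 = 0 \<and>
     (\<exists>hv hu :: real \<Rightarrow> real \<Rightarrow> real. \<forall>v u.
        ((\<lambda>s. h s u) has_real_derivative hv v u) (at v) \<and>
        ((\<lambda>s. h v s) has_real_derivative hu v u) (at u) \<and>
        min (m v) 0 \<le> hv v u \<and> hv v u \<le> 0 \<and>
        0 \<le> hu v u \<and> hu v u \<le> max (m u) 0)"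

text \<open>The value of the flux for \<open>u y = u x\<close> is arbitrary, since there it
  is only ever multiplied by \<open>sgn (u y - u x) = 0\<close>.\<close>

definition flux :: "(real \<Rightarrow> real \<Rightarrow> real) \<Rightarrow> ('a \<Rightarrow> real) \<Rightarrow> ('a \<Rightarrow> real) \<Rightarrow> 'a \<Rightarrow> 'a \<Rightarrow> real" where
  "flux h \<rho> u y x =
     (if sgn (u y - u x) = 1 then h (\<rho> y) (\<rho> x)
      else if sgn (u y - u x) = -1 then h (\<rho> x) (\<rho> y)
      else 0)"

definition hughes_system ::
  "'a pair_pre_digraph \<Rightarrow> 'a set \<Rightarrow> ('a \<Rightarrow> 'a \<Rightarrow> real) \<Rightarrow> (real \<Rightarrow> real \<Rightarrow> real) \<Rightarrow> real \<Rightarrow>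
   ('a \<Rightarrow> real) \<Rightarrow> (nat \<Rightarrow> 'a \<Rightarrow> real) \<Rightarrow> (nat \<Rightarrow> 'a \<Rightarrow> real) \<Rightarrow> bool" where
  "hughes_system G Vb w h lam \<rho>0 \<rho> u \<longleftrightarrow>
     (\<forall>n. \<forall>x\<in>pverts G.
        \<rho> (Suc n) x =
          \<rho> n x - (\<Sum>y\<in>nbrs G x. lam * flux h (\<rho> n) (u n) y x * sgn (u n y - u n x))) \<and>
     (\<forall>n. \<forall>x\<in>pverts G - Vb.
        Max ((\<lambda>y. - ((u n y - u n x) / w y x) - 1 / (1 - \<rho> n y)) ` nbrs G x) = 0) \<and>
     (\<forall>x\<in>pverts G. \<rho> 0 x = \<rho>0 x) \<and>
     (\<forall>n. \<forall>x\<in>Vb. u n x = 0)"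

end

theory Submission
  imports Defs
begin

text \<open>Multiplying by the weights, the second equation of the system says that
  \<open>u x\<close> is the minimum over \<open>y \<sim> x\<close> of \<open>u y + w y x / (1 - \<rho> y)\<close>, a discrete eikonal
  equation with positive costs. It has a unique solution: comparison is obtained
  by looking, among the maximisers of the difference of two solutions, at one
  where the second solution is smallest, and existence by Perron's method.
  Both derivative bounds and \<open>h 0 0 = h 1 1 = 0\<close> show that each flux term lies
  between \<open>- M (1 - \<rho> x)\<close> and \<open>M \<rho> x\<close>, where \<open>M\<close> bounds \<open>\<bar>m\<bar>\<close> on \<open>[0,1]\<close>; hence
  \<open>\<lambda> D M < 1\<close> makes \<open>0 \<le> \<rho> < 1\<close> invariant, and the sequences are determined recursively.\<close>

section \<open>The discrete eikonal equation on a finite set: comparison, uniqueness,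
  existence\<close>

text \<open>\<open>reach\<close> says, as an induction rule, that \<open>N\<close>-steps lead from
  every vertex to \<open>B\<close>; in this form connectedness enters. \<open>L\<close> merges
  weight and running cost into one edge cost.\<close>

locale eikonal =
  fixes V B :: "'a set" and N :: "'a \<Rightarrow> 'a set" and L :: "'a \<Rightarrow> 'a \<Rightarrow> real"
  assumes finite_V: "finite V"
    and B_subset: "B \<subseteq> V"
    and N_subset: "x \<in> V \<Longrightarrow> N x \<subseteq> V"
    and L_pos: "x \<in> V \<Longrightarrow> y \<in> N x \<Longrightarrow> 0 < L x y"
    and reach: "\<lbrakk>S \<subseteq> V; B \<subseteq> S; \<And>x y. x \<in> V \<Longrightarrow> y \<in> N x \<Longrightarrow> y \<in> S \<Longrightarrow> x \<in> S\<rbrakk> \<Longrightarrow> S = V"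
begin

definition subsol :: "('a \<Rightarrow> real) \<Rightarrow> bool" where
  "subsol u \<longleftrightarrow> (\<forall>x\<in>B. u x = 0) \<and> (\<forall>x\<in>V - B. \<forall>y\<in>N x. u x \<le> u y + L x y)"

text \<open>Attainment by some neighbour, together with \<open>subsol\<close>, expresses the minimum
  without a \<open>Min\<close> over a set that might be empty.\<close>

definition sol :: "('a \<Rightarrow> real) \<Rightarrow> bool" where
  "sol u \<longleftrightarrow> subsol u \<and> (\<forall>x\<in>V - B. \<exists>y\<in>N x. u x = u y + L x y)"

lemma subsol_le_sol:
  assumes u: "subsol u" and v: "sol v" and "x \<in> V"
  shows "u x \<le> v x"
proof -
  define M where "M = Max ((\<lambda>x. u x - v x) ` V)"
  define A where "A = {x \<in> V. u x - v x = M}"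
  have le_M: "u z - v z \<le> M" if "z \<in> V" for z
    using that finite_V unfolding M_def by simp
  have "M \<in> (\<lambda>x. u x - v x) ` V"
    using finite_V \<open>x \<in> V\<close> unfolding M_def by (intro Max_in) auto
  then have "A \<noteq> {}" "finite A" using finite_V by (auto simp: A_def)
  then obtain z where z: "z \<in> A" and z_min: "\<And>y. y \<in> A \<Longrightarrow> v z \<le> v y"
    by (metis arg_min_if_finite(1) arg_min_least)
  have "z \<in> B"
  proof (rule ccontr)
    assume "z \<notin> B"
    then have zV: "z \<in> V - B" using z by (auto simp: A_def)
    then obtain y where y: "y \<in> N z" "v z = v y + L z y" using v by (auto simp: sol_def)
    have "y \<in> V" "0 < L z y" using y zV N_subset L_pos by auto
    moreover have "u z \<le> u y + L z y" using u zV y by (auto simp: subsol_def)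
    \<comment> \<open>Subtracting the equality for \<open>v\<close> from the inequality for
      \<open>u\<close> gives \<open>u y - v y \<ge> M\<close>. So \<open>y\<close> is again a
      maximiser, but with \<open>v y < v z\<close>, against the choice of \<open>z\<close>.\<close>
    ultimately have "y \<in> A" using le_M[of y] y z by (auto simp: A_def)
    with z_min[of y] y \<open>0 < L z y\<close> show False by auto
  qed
  then have "M = 0" using z u v by (auto simp: A_def sol_def subsol_def)
  with le_M[OF \<open>x \<in> V\<close>] show ?thesis by simp
qed

lemma sol_unique: "sol u \<Longrightarrow> sol v \<Longrightarrow> x \<in> V \<Longrightarrow> u x = v x"
  by (meson antisym sol_def subsol_le_sol)

lemma subsol_zero: "subsol (\<lambda>x. 0)"
  using L_pos by (force simp: subsol_def)

text \<open>The bound is 0 on \<open>B\<close> and grows by one edge cost per step away from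
  \<open>B\<close>, uniformly in \<open>u\<close>. This makes the supremum in Perron's method
  finite.\<close>

lemma subsol_bounded:
  assumes "x \<in> V"
  shows "\<exists>C. \<forall>u. subsol u \<longrightarrow> u x \<le> C"
proof -
  let ?S = "{x \<in> V. \<exists>C. \<forall>u. subsol u \<longrightarrow> u x \<le> C}"
  have "?S = V"
  proof (rule reach)
    show "B \<subseteq> ?S" using B_subset by (auto simp: subsol_def)
    fix x y assume x: "x \<in> V" and y: "y \<in> N x" "y \<in> ?S"
    then obtain C where C: "\<And>u. subsol u \<Longrightarrow> u y \<le> C" by auto
    show "x \<in> ?S"
    proof (cases "x \<in> B")
      case True
      then show ?thesis using x by (auto simp: subsol_def)
    next
      case False
      have "u x \<le> C + L x y" if "subsol u" for u
      proof -
        have "u x \<le> u y + L x y" using that False x y by (auto simp: subsol_def)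
        then show ?thesis using C[OF that] by simp
      qed
      then show ?thesis using x by blast
    qed
  qed auto
  with assms show ?thesis by auto
qed

text \<open>The pointwise supremum \<open>U\<close> of all subsolutions is a subsolution. At a
  vertex where no neighbour attained equality, \<open>U\<close> could be raised at that vertex
  alone, against maximality.\<close>

lemma sol_exists: "\<exists>u. sol u"
proof -
  define U where "U x = (SUP u\<in>Collect subsol. u x)" for x
  have bdd: "bdd_above ((\<lambda>u. u x) ` Collect subsol)" if "x \<in> V" for x
    using subsol_bounded[OF that] by (auto simp: bdd_above_def)
  have upper: "u x \<le> U x" if "subsol u" "x \<in> V" for u x
    unfolding U_def using that bdd by (intro cSUP_upper) auto
  have least: "U x \<le> C" if "\<And>u. subsol u \<Longrightarrow> u x \<le> C" for x C
    unfolding U_def using that subsol_zero by (intro cSUP_least) auto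
  have sub: "subsol U"
    unfolding subsol_def
  proof (intro conjI ballI)
    fix x assume "x \<in> B"
    then show "U x = 0"
      using upper[OF subsol_zero, of x] least[of x 0] B_subset by (force simp: subsol_def)
  next
    fix x y assume x: "x \<in> V - B" and y: "y \<in> N x"
    have "u x \<le> U y + L x y" if "subsol u" for u
    proof -
      have "u x \<le> u y + L x y" using that x y by (auto simp: subsol_def)
      moreover have "u y \<le> U y" using upper that x y N_subset by auto
      ultimately show ?thesis by simp
    qed
    then show "U x \<le> U y + L x y" by (rule least)
  qed
  have "\<exists>y\<in>N x. U x = U y + L x y" if x: "x \<in> V - B" for x
  proof (rule ccontr)
    assume "\<not> ?thesis"
    then have pos: "0 < U y + L x y - U x" if "y \<in> N x" for y
      using sub that x unfolding subsol_def by force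
    have fin: "finite (N x)" using x N_subset finite_V by (meson Diff_iff finite_subset)
    \<comment> \<open>The smallest slack at \<open>x\<close>; the inserted 1 keeps
      \<open>Min\<close> meaningful should \<open>N x\<close> be empty.\<close>
    define e where "e = Min (insert 1 ((\<lambda>y. U y + L x y - U x) ` N x))"
    have "0 < e" unfolding e_def using fin pos by (subst Min_gr_iff) auto
    have e: "e \<le> U y + L x y - U x" if "y \<in> N x" for y
      unfolding e_def using fin that by (intro Min_le) auto
    have "subsol (U(x := U x + e))"
      unfolding subsol_def
    proof (intro conjI ballI)
      fix z assume "z \<in> B"
      then show "(U(x := U x + e)) z = 0" using sub x by (auto simp: subsol_def)
    next
      fix z y assume z: "z \<in> V - B" "y \<in> N z"
      \<comment> \<open>Raising \<open>U x\<close> uses up slack only at \<open>z = x\<close>; where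
        \<open>x\<close> is the neighbour it relaxes the inequality. Positivity of \<open>L\<close>
        settles a loop \<open>z = y = x\<close>.\<close>
      then have "U z \<le> U y + L z y" "0 < L z y" using sub L_pos by (auto simp: subsol_def)
      then show "(U(x := U x + e)) z \<le> (U(x := U x + e)) y + L z y"
        using e[of y] z \<open>0 < e\<close> by (auto simp: fun_upd_def)
    qed
    from upper[OF this, of x] x \<open>0 < e\<close> show False by simp
  qed
  with sub show ?thesis by (auto simp: sol_def)
qed

text \<open>Since \<open>sol\<close> sees only values on \<open>V\<close>, uniqueness as a function
  is stated among extensional functions.\<close>

lemma ex1_sol: "\<exists>!u. u \<in> V \<rightarrow>\<^sub>E UNIV \<and> sol u"
proof -
  obtain u where "sol u" using sol_exists by blast
  moreover have "y \<in> V" if "x \<in> V - B" "y \<in> N x" for x y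
    using that N_subset by auto
  ultimately have "sol (restrict u V)"
    using B_subset unfolding sol_def subsol_def by (auto simp: subset_iff)
  moreover have "restrict u V \<in> V \<rightarrow>\<^sub>E UNIV" by simp
  ultimately show ?thesis
    by (intro ex1I[of _ "restrict u V"]) (blast intro: PiE_ext sol_unique)+
qed

text \<open>A finite nonempty maximum is 0 iff all terms are at most 0 and one equals 0; multiplying
  by \<open>k x y > 0\<close> turns these conditions into those of \<open>sol\<close>.\<close>

lemma sol_iff_Max:
  assumes pos: "\<And>x y. x \<in> V \<Longrightarrow> y \<in> N x \<Longrightarrow> 0 < k x y"
    and L: "\<And>x y. x \<in> V \<Longrightarrow> y \<in> N x \<Longrightarrow> L x y = k x y * c y"
  shows "sol u \<longleftrightarrow> (\<forall>x\<in>V - B. Max ((\<lambda>y. - ((u y - u x) / k x y) - c y) ` N x) = 0) \<and>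
    (\<forall>x\<in>B. u x = 0)"
proof -
  have "Max ((\<lambda>y. - ((u y - u x) / k x y) - c y) ` N x) = 0 \<longleftrightarrow>
      (\<forall>y\<in>N x. u x \<le> u y + L x y) \<and> (\<exists>y\<in>N x. u x = u y + L x y)"
    if x: "x \<in> V - B" for x
  proof -
    \<comment> \<open>A vertex outside \<open>B\<close> without neighbours could be removed from
      \<open>V\<close> without violating the closure condition in \<open>reach\<close>.\<close>
    have "N x \<noteq> {}"
    proof
      assume "N x = {}"
      then have "V - {x} = V" using x N_subset B_subset by (intro reach) auto
      with x show False by auto
    qed
    moreover have "finite (N x)" using x N_subset finite_V by (meson Diff_iff finite_subset)
    moreover have
      "- ((u y - u x) / k x y) - c y \<le> 0 \<longleftrightarrow> u x \<le> u y + L x y"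
      "0 = - ((u y - u x) / k x y) - c y \<longleftrightarrow> u x = u y + L x y" if "y \<in> N x" for y
      using pos[of x y] L[of x y] x that by (auto simp: field_simps)
    ultimately show ?thesis by (subst Max_eq_iff) (auto simp: image_iff)
  qed
  then show ?thesis by (auto simp: sol_def subsol_def)
qed

end

section \<open>Flux bounds and invariance of the density range\<close>

text \<open>By continuity the set where the essential bound holds is closed; having full measure in
  the open interval, it contains that interval and hence its endpoints.\<close>

lemma Linfty_norm_ge:
  fixes m :: "real \<Rightarrow> real"
  assumes cont: "continuous_on UNIV m" and "a < b" and "x \<in> {a..b}"
  shows "ereal \<bar>m x\<bar> \<le> Linfty_norm {a<..<b} m"
proof -
  let ?C = "{x. ereal \<bar>m x\<bar> \<le> Linfty_norm {a<..<b} m}"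
  have closed: "closed ?C"
    using cont by (intro closed_Collect_le continuous_intros)
  have "AE x in lebesgue_on {a<..<b}. x \<in> ?C"
    using esssup_AE[of "\<lambda>x. ereal \<bar>m x\<bar>" "lebesgue_on {a<..<b}"] by (simp add: Linfty_norm_def)
  then have "AE x\<in>{a<..<b} in lebesgue. x \<in> ?C"
    by (subst (asm) AE_restrict_space_iff) auto
  then have "{a<..<b} \<subseteq> ?C"
    using mem_closed_if_AE_lebesgue_open[OF open_greaterThanLessThan closed] by blast
  then have "closure {a<..<b} \<subseteq> ?C" using closed by (rule closure_minimal)
  with assms show ?thesis by auto
qed

text \<open>Monotonicity pushes the argument \<open>b\<close> to 0 or 1; then \<open>a\<close> is
  moved to the same endpoint, where \<open>h\<close> vanishes, at a cost of at most \<open>M\<close>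
  times the distance. Thus the bounds depend on \<open>a\<close> only.\<close>

lemma admissible_flux_bounds:
  fixes a b M :: real
  assumes h: "admissible_flux h m" and M: "\<And>x. x \<in> {0..1} \<Longrightarrow> \<bar>m x\<bar> \<le> M"
    and a: "a \<in> {0..1}" and b: "b \<in> {0..1}"
  shows "- M * (1 - a) \<le> h b a" "h b a \<le> M * a" "- M * a \<le> h a b" "h a b \<le> M * (1 - a)"
proof -
  obtain hv hu where d:
    "\<And>v u. ((\<lambda>s. h s u) has_real_derivative hv v u) (at v)"
    "\<And>v u. ((\<lambda>s. h v s) has_real_derivative hu v u) (at u)"
    "\<And>v u. min (m v) 0 \<le> hv v u" "\<And>v u. hv v u \<le> 0"
    "\<And>v u. 0 \<le> hu v u" "\<And>v u. hu v u \<le> max (m u) 0"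
    using h unfolding admissible_flux_def by metis
  have h0: "h 0 0 = 0" "h 1 1 = 0" using h by (auto simp: admissible_flux_def)
  have anti: "h t u \<le> h s u" if "s \<le> t" for s t u
    using DERIV_nonpos_imp_nonincreasing[OF that, of "\<lambda>s. h s u"] d by blast
  have hv_M: "- M \<le> hv v u" if "v \<in> {0..1}" for v u
    using d(3)[of v u] M[OF that] by linarith
  have hu_M: "hu v u \<le> M" if "u \<in> {0..1}" for v u
    using d(6)[of v u] M[OF that] by linarith
  \<comment> \<open>One-sided Lipschitz bounds, obtained as monotonicity of \<open>h\<close> after
    adding or subtracting a linear term of slope \<open>M\<close>.\<close>
  have lipv: "h s u + M * s \<le> h t u + M * t" if "0 \<le> s" "s \<le> t" "t \<le> 1" for s t u
  proof (rule DERIV_nonneg_imp_nondecreasing[OF \<open>s \<le> t\<close>, of "\<lambda>s. h s u + M * s"])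
    fix x assume "s \<le> x" "x \<le> t"
    then have "0 \<le> hv x u + M" using hv_M[of x u] that by auto
    then show "\<exists>y. ((\<lambda>s. h s u + M * s) has_real_derivative y) (at x) \<and> 0 \<le> y"
      by (intro exI[of _ "hv x u + M"]) (auto intro!: derivative_eq_intros d(1))
  qed
  have lipu: "h v t - M * t \<le> h v s - M * s" if "0 \<le> s" "s \<le> t" "t \<le> 1" for s t v
  proof (rule DERIV_nonpos_imp_nonincreasing[OF \<open>s \<le> t\<close>, of "\<lambda>s. h v s - M * s"])
    fix x assume "s \<le> x" "x \<le> t"
    then have "hu v x - M \<le> 0" using hu_M[of x v] that by auto
    then show "\<exists>y. ((\<lambda>s. h v s - M * s) has_real_derivative y) (at x) \<and> y \<le> 0"
      by (intro exI[of _ "hu v x - M"]) (auto intro!: derivative_eq_intros d(2))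
  qed
  have mono: "h v s \<le> h v t" if "s \<le> t" for s t v
    using DERIV_nonneg_imp_nondecreasing[OF that, of "\<lambda>s. h v s"] d by blast
  show "- M * (1 - a) \<le> h b a"
    using lipu[of a 1 1] anti[of b 1 a] a b h0 by (auto simp: algebra_simps)
  show "h b a \<le> M * a"
    using lipu[of 0 a 0] anti[of 0 b a] a b h0 by (auto simp: algebra_simps)
  show "- M * a \<le> h a b"
    using lipv[of 0 a 0] mono[of 0 b a] a b h0 by (auto simp: algebra_simps)
  show "h a b \<le> M * (1 - a)"
    using lipv[of a 1 1] mono[of b 1 a] a b h0 by (auto simp: algebra_simps)
qed

text \<open>For sign 1, \<open>\<rho> x\<close> is the second argument of \<open>h\<close>; for sign
  -1 it is the first and the bounds are negated, which yields the same interval.\<close>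

lemma flux_term_bounds:
  assumes h: "admissible_flux h m" and M: "\<And>x. x \<in> {0..1} \<Longrightarrow> \<bar>m x\<bar> \<le> M"
    and r: "\<rho> x \<in> {0..1}" "\<rho> y \<in> {0..1}"
  shows "- M * (1 - \<rho> x) \<le> flux h \<rho> u y x * sgn (u y - u x)"
    and "flux h \<rho> u y x * sgn (u y - u x) \<le> M * \<rho> x"
proof -
  note bnds = admissible_flux_bounds[OF h M r]
  have "0 \<le> M" using M[of 0] by auto
  then have "0 \<le> M * (1 - \<rho> x)" "0 \<le> M * \<rho> x" using r by auto
  then show "- M * (1 - \<rho> x) \<le> flux h \<rho> u y x * sgn (u y - u x)"
    and "flux h \<rho> u y x * sgn (u y - u x) \<le> M * \<rho> x"
    using bnds by (auto simp: flux_def sgn_if)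
qed

text \<open>With \<theta> = \<open>lam * card A * M\<close> < 1, the flux bounds give
  \<open>r \<ge> (1 - \<theta>) * \<rho> x\<close> and
  \<open>1 - r \<ge> (1 - \<theta>) * (1 - \<rho> x)\<close>.\<close>

lemma density_step_bounds:
  fixes u :: "'a \<Rightarrow> real"
  assumes h: "admissible_flux h m" and M: "\<And>x. x \<in> {0..1} \<Longrightarrow> \<bar>m x\<bar> \<le> M"
    and lam: "0 \<le> lam" and D: "card A \<le> D" "lam * real D * M < 1"
    and x: "0 \<le> \<rho> x" "\<rho> x < 1" and A: "\<And>y. y \<in> A \<Longrightarrow> \<rho> y \<in> {0..1}"
  defines "r \<equiv> \<rho> x - (\<Sum>y\<in>A. lam * flux h \<rho> u y x * sgn (u y - u x))"
  shows "0 \<le> r" "r < 1"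
proof -
  let ?S = "\<Sum>y\<in>A. flux h \<rho> u y x * sgn (u y - u x)"
  have "0 \<le> M" using M[of 0] by auto
  then have "lam * (real (card A) * M) \<le> lam * (real D * M)"
    using D lam by (intro mult_left_mono mult_right_mono) auto
  then have K: "lam * real (card A) * M < 1" using D by (simp add: mult.assoc)
  note bnds = flux_term_bounds[OF h M, of \<rho> x _ u]
  have "?S \<le> real (card A) * (M * \<rho> x)"
    using x A by (intro sum_bounded_above bnds(2)) auto
  then have up: "lam * ?S \<le> lam * real (card A) * M * \<rho> x"
    using mult_left_mono[OF _ lam] by (simp add: mult.assoc)
  have "real (card A) * (- M * (1 - \<rho> x)) \<le> ?S"
    using x A by (intro sum_bounded_below bnds(1)) auto
  then have lo: "- (lam * real (card A) * M * (1 - \<rho> x)) \<le> lam * ?S"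
    using mult_left_mono[OF _ lam] by (fastforce simp: mult.assoc)
  have r: "r = \<rho> x - lam * ?S" by (simp add: r_def sum_distrib_left mult.assoc)
  have "lam * real (card A) * M * \<rho> x \<le> 1 * \<rho> x" using K x by (intro mult_right_mono) auto
  then show "0 \<le> r" using up r by simp
  have "lam * real (card A) * M * (1 - \<rho> x) < 1 * (1 - \<rho> x)"
    using K x by (intro mult_strict_right_mono) auto
  then show "r < 1" using lo r by simp
qed

section \<open>From the graph to the eikonal problem, and recursion in time\<close>

text \<open>Supplies \<open>reach\<close>. Connectedness is strong connectedness of the symmetrised
  graph; as the arcs are already symmetric, each vertex has a path in \<open>G\<close> to some
  \<open>b\<close> in \<open>S\<close>, and membership in \<open>S\<close> travels back along
  it.\<close>

lemma connected_closed_eq_verts: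
  assumes G: "pair_graph G" and conn: "Digraph_Component.connected (with_proj G)"
    and S: "S \<subseteq> pverts G" "S \<noteq> {}"
    and closed: "\<And>x y. x \<in> pverts G \<Longrightarrow> y \<in> nbrs G x \<Longrightarrow> y \<in> S \<Longrightarrow> x \<in> S"
  shows "S = pverts G"
proof -
  interpret pair_graph G by fact
  obtain b where b: "b \<in> S" using S by auto
  have "x \<in> S" if x: "x \<in> pverts G" for x
  proof -
    have "x \<rightarrow>\<^sup>*\<^bsub>with_proj (mk_symmetric (with_proj G))\<^esub> b"
      using conn x b S unfolding Digraph_Component.connected_def
      by (auto simp: strongly_connected_def)
    then have "x \<rightarrow>\<^sup>*\<^bsub>with_proj G\<^esub> b"
      using reachable_mk_symmetric_eq pair_sym_arcs by simp
    then show ?thesis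
    proof (induction rule: converse_reachable_induct)
      case (step x y)
      then have "(x, y) \<in> parcs G" by simp
      then have "x \<in> pverts G" "y \<in> nbrs G x"
        using arc_fst_in_verts arc_snd_in_verts by (force simp: nbrs_def)+
      with closed step.IH show ?case by blast
    qed (rule b)
  qed
  with S show ?thesis by auto
qed

text \<open>Under the invariant \<open>P\<close>, \<open>Q\<close> makes \<open>u\<close> a function
  \<open>E\<close> of \<open>r\<close>, so the system is an ordinary recursion. A competing pair is
  not assumed to satisfy \<open>P\<close>: it agrees with \<open>R\<close> by induction and inherits
  \<open>P\<close> from it.\<close>

lemma ex1_coupled_recursion:
  assumes r0: "P r0"
    and Q: "\<And>r. P r \<Longrightarrow> \<exists>!u. Q r u"
    and T: "\<And>r u. P r \<Longrightarrow> Q r u \<Longrightarrow> P (T r u)"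
  shows "\<exists>!(r, u). r 0 = r0 \<and> (\<forall>n. r (Suc n) = T (r n) (u n)) \<and> (\<forall>n::nat. Q (r n) (u n))"
proof -
  define E where "E r = (THE u. Q r u)" for r
  have E: "Q r (E r)" if "P r" for r
    unfolding E_def by (rule theI'[OF Q[OF that]])
  have E_eq: "u = E r" if "P r" "Q r u" for r u
    using that Q[OF \<open>P r\<close>] E[OF \<open>P r\<close>] by auto
  define R where "R n = ((\<lambda>r. T r (E r)) ^^ n) r0" for n
  have R_Suc: "R (Suc n) = T (R n) (E (R n))" for n by (simp add: R_def)
  have PR: "P (R n)" for n
    by (induction n) (simp add: R_def r0, simp add: R_Suc E T)
  show ?thesis
  proof (rule ex1I[of _ "(R, \<lambda>n. E (R n))"], goal_cases)
    case 1
    show ?case using E[OF PR] R_Suc by (simp add: R_def)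
  next
    case (2 p)
    obtain r u where p: "p = (r, u)" by (cases p)
    have r: "r 0 = r0" "\<And>n. r (Suc n) = T (r n) (u n)" "\<And>n. Q (r n) (u n)"
      using 2 p by auto
    have "r n = R n" for n
    proof (induction n)
      case 0
      show ?case using r by (simp add: R_def)
    next
      case (Suc n)
      then show ?case using r(2)[of n] r(3)[of n] E_eq[OF PR, of n] by (simp add: R_Suc)
    qed
    moreover from this have "u n = E (R n)" for n
      using r(3)[of n] E_eq[OF PR] by simp
    ultimately show ?case using p by (simp add: fun_eq_iff)
  qed
qed

lemma eikonal_graph:
  assumes "pair_graph G" and "Digraph_Component.connected (with_proj G)"
    and w: "graph_weight G w" and "Vb \<subseteq> pverts G" "Vb \<noteq> {}"
    and c: "\<And>y. y \<in> pverts G \<Longrightarrow> 0 < c y"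
  shows "eikonal (pverts G) Vb (nbrs G) (\<lambda>x y. w y x * c y)"
proof
  show "finite (pverts G)"
    using assms(1) by (simp add: pair_graph_def pair_digraph_def pair_fin_digraph.pair_finite_verts)
  show "nbrs G x \<subseteq> pverts G" for x by (auto simp: nbrs_def)
  show "0 < w y x * c y" if "x \<in> pverts G" "y \<in> nbrs G x" for x y
    using that w c unfolding graph_weight_def nbrs_def by (metis mem_Collect_eq mult_pos_pos)
  show "S = pverts G"
    if "S \<subseteq> pverts G" "Vb \<subseteq> S" "\<And>x y. x \<in> pverts G \<Longrightarrow> y \<in> nbrs G x \<Longrightarrow> y \<in> S \<Longrightarrow> x \<in> S" for S
    using connected_closed_eq_verts[OF assms(1,2)] that \<open>Vb \<noteq> {}\<close> by blast
qed fact

definition potential_of ::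
    "'a pair_pre_digraph \<Rightarrow> 'a set \<Rightarrow> ('a \<Rightarrow> 'a \<Rightarrow> real) \<Rightarrow> ('a \<Rightarrow> real) \<Rightarrow> ('a \<Rightarrow> real) \<Rightarrow> bool" where
  "potential_of G Vb w \<rho> u \<longleftrightarrow> u \<in> pverts G \<rightarrow>\<^sub>E UNIV \<and>
     (\<forall>x\<in>pverts G - Vb. Max ((\<lambda>y. - ((u y - u x) / w y x) - 1 / (1 - \<rho> y)) ` nbrs G x) = 0) \<and>
     (\<forall>x\<in>Vb. u x = 0)"

text \<open>\<open>\<rho> < 1\<close> makes the running cost \<open>1 / (1 - \<rho> y)\<close>, and
  with it every edge cost, positive.\<close>

lemma ex1_potential:
  assumes "pair_graph G" and "Digraph_Component.connected (with_proj G)"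
    and w: "graph_weight G w" and Vb: "Vb \<subseteq> pverts G" "Vb \<noteq> {}"
    and \<rho>: "\<And>x. x \<in> pverts G \<Longrightarrow> \<rho> x < 1"
  shows "\<exists>!u. potential_of G Vb w \<rho> u"
proof -
  interpret E: eikonal "pverts G" Vb "nbrs G" "\<lambda>x y. w y x * (1 / (1 - \<rho> y))"
    by (rule eikonal_graph) (use assms in auto)
  have w_pos: "0 < w y x" if "x \<in> pverts G" "y \<in> nbrs G x" for x y
    using that w unfolding graph_weight_def nbrs_def by (metis mem_Collect_eq)
  have pot: "potential_of G Vb w \<rho> u \<longleftrightarrow> u \<in> pverts G \<rightarrow>\<^sub>E UNIV \<and> E.sol u" for u
    unfolding potential_of_def
    by (subst E.sol_iff_Max[where k = "\<lambda>x y. w y x" and c = "\<lambda>y. 1 / (1 - \<rho> y)"])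
      (use w_pos in auto)
  show ?thesis unfolding pot by (rule E.ex1_sol)
qed

text \<open>Replaces the extended-real norm by a real bound: the maximum of
  \<open>\<bar>m\<bar>\<close> on [0,1], which the essential supremum dominates.\<close>

lemma flux_constant_exists:
  assumes m: "continuous_on UNIV m" and K: "0 \<le> K"
    and norm: "ereal K * Linfty_norm {0<..<1} m < 1"
  shows "\<exists>M. (\<forall>x\<in>{0..1}. \<bar>m x\<bar> \<le> M) \<and> K * M < 1"
proof -
  have "continuous_on {0..1} (\<lambda>x. \<bar>m x\<bar>)"
    using continuous_on_subset[OF m] by (intro continuous_intros) auto
  then obtain p where p: "p \<in> {0..1}" "\<And>x. x \<in> {0..1} \<Longrightarrow> \<bar>m x\<bar> \<le> \<bar>m p\<bar>"
    using continuous_attains_sup[of "{0..1::real}" "\<lambda>x. \<bar>m x\<bar>"] by auto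
  have "ereal K * ereal \<bar>m p\<bar> \<le> ereal K * Linfty_norm {0<..<1} m"
    using Linfty_norm_ge[OF m _ p(1)] K by (intro ereal_mult_left_mono) auto
  then have "ereal K * ereal \<bar>m p\<bar> < 1" using norm by (rule le_less_trans)
  then show ?thesis using p by (intro exI[of _ "\<bar>m p\<bar>"]) (simp add: one_ereal_def)
qed

theorem corollary4p1:
  fixes G :: "'a pair_pre_digraph"
    and Vb :: "'a set"
    and w :: "'a \<Rightarrow> 'a \<Rightarrow> real"
    and h :: "real \<Rightarrow> real \<Rightarrow> real"
    and m :: "real \<Rightarrow> real"
    and lam :: real
    and \<rho>0 :: "'a \<Rightarrow> real"
  assumes "pair_graph G"
    and "Digraph_Component.connected (with_proj G)"
    and "graph_weight G w"
    and "Vb \<subseteq> pverts G" and "Vb \<noteq> {}"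
    and "lam > 0"
    and "continuous_on UNIV m"
    and "admissible_flux h m"
    and "ereal (lam * real (max_degree G)) * Linfty_norm {0<..<1} m < 1"
    and "\<And>x. x \<in> pverts G \<Longrightarrow> 0 \<le> \<rho>0 x \<and> \<rho>0 x < 1"
  shows "\<exists>!(\<rho>, u).
           (\<forall>n. \<rho> n \<in> pverts G \<rightarrow>\<^sub>E (UNIV :: real set)) \<and>
           (\<forall>n. u n \<in> pverts G \<rightarrow>\<^sub>E (UNIV :: real set)) \<and>
           (\<forall>n. \<forall>x\<in>pverts G. \<rho> n x < 1) \<and>
           hughes_system G Vb w h lam \<rho>0 \<rho> u"
proof -
  let ?V = "pverts G"
  \<comment> \<open>The lower bound 0 is part of the invariant because the flux bounds require
    densities in [0,1].\<close>
  define P where "P \<rho> \<longleftrightarrow> (\<forall>x\<in>?V. 0 \<le> \<rho> x \<and> \<rho> x < 1)" for \<rho> :: "'a \<Rightarrow> real"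
  \<comment> \<open>Restricting to the vertices keeps every iterate extensional.\<close>
  define T where "T \<rho> u = (\<lambda>x\<in>?V. \<rho> x -
    (\<Sum>y\<in>nbrs G x. lam * flux h \<rho> u y x * sgn (u y - u x)))" for \<rho> u :: "'a \<Rightarrow> real"
  let ?r0 = "restrict \<rho>0 ?V"
  have "0 \<le> lam * real (max_degree G)" using \<open>lam > 0\<close> by simp
  then obtain M where M: "\<And>x. x \<in> {0..1} \<Longrightarrow> \<bar>m x\<bar> \<le> M" "lam * real (max_degree G) * M < 1"
    using flux_constant_exists assms(7,9) by blast
  have fin: "finite ?V"
    using assms(1) by (simp add: pair_graph_def pair_digraph_def pair_fin_digraph.pair_finite_verts)
  have P_T: "P (T \<rho> u)" if "P \<rho>" for \<rho> u
    unfolding P_def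
  proof
    fix x assume x: "x \<in> ?V"
    have "card (nbrs G x) \<le> max_degree G"
      unfolding max_degree_def using fin x by (intro Max_ge) auto
    moreover have "\<rho> y \<in> {0..1}" if "y \<in> nbrs G x" for y
      using \<open>P \<rho>\<close> that by (force simp: P_def nbrs_def)
    ultimately show "0 \<le> T \<rho> u x \<and> T \<rho> u x < 1"
      using density_step_bounds[OF assms(8) M(1) _ _ M(2), of "nbrs G x" \<rho> x u] x \<open>P \<rho>\<close> \<open>lam > 0\<close>
      by (simp add: T_def P_def)
  qed
  have P0: "P ?r0" using assms(10) by (auto simp: P_def)
  have "\<exists>!(\<rho>, u). \<rho> 0 = ?r0 \<and> (\<forall>n. \<rho> (Suc n) = T (\<rho> n) (u n)) \<and>
      (\<forall>n::nat. potential_of G Vb w (\<rho> n) (u n))"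
    using P0 ex1_potential[OF assms(1-5)] P_T
    by (intro ex1_coupled_recursion[of P]) (auto simp: P_def)
  moreover have "(\<rho> 0 = ?r0 \<and> (\<forall>n. \<rho> (Suc n) = T (\<rho> n) (u n)) \<and>
        (\<forall>n. potential_of G Vb w (\<rho> n) (u n))) \<longleftrightarrow>
      (\<forall>n. \<rho> n \<in> ?V \<rightarrow>\<^sub>E (UNIV :: real set)) \<and> (\<forall>n. u n \<in> ?V \<rightarrow>\<^sub>E (UNIV :: real set)) \<and>
      (\<forall>n. \<forall>x\<in>?V. \<rho> n x < 1) \<and> hughes_system G Vb w h lam \<rho>0 \<rho> u"
    (is "?L \<longleftrightarrow> ?R") for \<rho> u :: "nat \<Rightarrow> 'a \<Rightarrow> real"
  proof
    assume L: ?L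
    \<comment> \<open>Invariance along the recursion provides the required
      \<open>\<rho> n x < 1\<close>.\<close>
    have "P (\<rho> n)" for n
      by (induction n) (use L P0 P_T in metis)+
    moreover have "\<rho> n \<in> ?V \<rightarrow>\<^sub>E UNIV" for n
      by (cases n) (use L in \<open>auto simp: T_def\<close>)
    ultimately show ?R
      using L by (auto simp: hughes_system_def potential_of_def P_def T_def)
  next
    assume R: ?R
    \<comment> \<open>Extensionality upgrades the equations at the vertices to equalities of
      functions.\<close>
    have "\<rho> 0 = ?r0"
      using R by (intro PiE_ext[of _ ?V "\<lambda>_. UNIV"]) (auto simp: hughes_system_def)
    moreover have "\<rho> (Suc n) = T (\<rho> n) (u n)" for n
      using R by (intro PiE_ext[of _ ?V "\<lambda>_. UNIV"]) (auto simp: hughes_system_def T_def)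
    ultimately show ?L
      using R by (auto simp: hughes_system_def potential_of_def)
  qed
  ultimately show ?thesis by simp
qed

end
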